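(* Let $U \subseteq \mathbb{R}^d$ and $\Sigma\subseteq\mathbb{R}^m$ with $d,m\ge 1$, let $\varepsilon>0$, let $\mathcal{U}=\{\boldsymbol{u}_1,\ldots,\boldsymbol{u}_n\}\subseteq U$ be a set of distinct points, and let $\Psi:U\to\Sigma$ be a scaling function. Let $\mathsf{K}\in\mathbb{R}^{n\times n}$ be the matrix of the Matérn $C^0$ kernel $K_\varepsilon(\boldsymbol{w},\boldsymbol{z})=e^{-\varepsilon\|\boldsymbol{w}-\boldsymbol{z}\|_2}$ on $\mathcal{U}$, and let $\mathsf{K}^{\Psi}\in\mathbb{R}^{n\times n}$ be the matrix on $\mathcal{U}$ of the associated Matérn $C^0$ variably scaled kernel $K_\varepsilon^\Psi$. If the matrix $$\mathsf{K}^{\circ(\varepsilon\mathsf{D}-1)}\circ\mathsf{K}_G^{\varphi}\circ\left((\mathsf{K}^{\Psi})^{\circ(\varepsilon\mathsf{D}^{\Psi}-1)}\right)^{\circ -1}$$ is positive definite, then $$\mathrm{cond}(\mathsf{K}^{\Psi})\le\mathrm{cond}(\mathsf{K}).$$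
   Context: Variably scaled kernel: $K_\varepsilon^{\Psi}(\boldsymbol{w},\boldsymbol{z}) = e^{-\varepsilon\|(\boldsymbol{w},\Psi(\boldsymbol{w}))-(\boldsymbol{z},\Psi(\boldsymbol{z}))\|_2}$ for $\boldsymbol{w},\boldsymbol{z}\in U$, where $(\boldsymbol{w},\Psi(\boldsymbol{w}))\in\mathbb{R}^{d+m}$ and $\|\cdot\|_2$ is the Euclidean norm. The kernel matrices are $\mathsf{K}_{ij}=K_\varepsilon(\boldsymbol{u}_i,\boldsymbol{u}_j)$ and $\mathsf{K}^{\Psi}_{ij}=K_\varepsilon^{\Psi}(\boldsymbol{u}_i,\boldsymbol{u}_j)$, $i,j=1,\ldots,n$. Distance matrices: $\mathsf{D}_{ij}=\|\boldsymbol{u}_i-\boldsymbol{u}_j\|_2$ and $\mathsf{D}^{\Psi}_{ij}=\|(\boldsymbol{u}_i,\Psi(\boldsymbol{u}_i))-(\boldsymbol{u}_j,\Psi(\boldsymbol{u}_j))\|_2$, $i,j=1,\ldots,n$. The matrix $\mathsf{K}_G^{\varphi}\in\mathbb{R}^{n\times n}$ has entries $(\mathsf{K}_G^{\varphi})_{ij}=e^{-\varepsilon^2\|\Psi(\boldsymbol{u}_i)-\Psi(\boldsymbol{u}_j)\|_2^2}$ (Gaussian kernel applied to the values of the scaling function). Entrywise operations: $\circ$ between matrices is the entrywise (Hadamard) product. For a matrix $\mathsf{A}$ with positive entries and a real matrix $\mathsf{B}$ of the same size, $\mathsf{A}^{\circ\mathsf{B}}$ is the matrix with entries $\mathsf{A}_{ij}^{\mathsf{B}_{ij}}$;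 $\varepsilon\mathsf{D}-1$ is the matrix with entries $\varepsilon\mathsf{D}_{ij}-1$ (and likewise $\varepsilon\mathsf{D}^\Psi-1$); $\mathsf{A}^{\circ -1}$ is the entrywise reciprocal, with entries $1/\mathsf{A}_{ij}$. Positive definite means that the real symmetric matrix has only positive eigenvalues. The condition number is $\mathrm{cond}(\mathsf{M})=\|\mathsf{M}\|_2\|\mathsf{M}^{-1}\|_2$, with $\|\cdot\|_2$ the spectral norm. *)

theory Defs
  imports "HOL-Analysis.Analysis"
begin

definition matrix_eigenvalue :: "real^'n^'n \<Rightarrow> real \<Rightarrow> bool" where
  "matrix_eigenvalue A c \<longleftrightarrow> (\<exists>v. v \<noteq> 0 \<and> A *v v = c *s v)"

text \<open>Only real eigenvalues are mentioned below: a real symmetric matrix has no others.\<close>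

definition matrix_pos_def :: "real^'n^'n \<Rightarrow> bool" where
  "matrix_pos_def A \<longleftrightarrow> transpose A = A \<and> (\<forall>c. matrix_eigenvalue A c \<longrightarrow> c > 0)"

definition spectral_norm :: "real^'n^'m \<Rightarrow> real" where
  "spectral_norm A = onorm (\<lambda>x. A *v x)"

text \<open>Meaningful for invertible matrices only, since \<^const>\<open>matrix_inv\<close> is unspecified otherwise.\<close>

definition cond :: "real^'n^'n \<Rightarrow> real" where
  "cond A = spectral_norm A * spectral_norm (matrix_inv A)"

definition hadamard :: "real^'n^'m \<Rightarrow> real^'n^'m \<Rightarrow> real^'n^'m"  (infixl "\<circ>\<^sub>H" 70) where
  "A \<circ>\<^sub>H B = (\<chi> i j. A $ i $ j * B $ i $ j)"

definition hadamard_powr :: "real^'n^'m \<Rightarrow> real^'n^'m \<Rightarrow> real^'n^'m" where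
  "hadamard_powr A B = (\<chi> i j. (A $ i $ j) powr (B $ i $ j))"

definition hadamard_inverse :: "real^'n^'m \<Rightarrow> real^'n^'m" where
  "hadamard_inverse A = (\<chi> i j. 1 / A $ i $ j)"

definition matern :: "real \<Rightarrow> 'a::real_normed_vector \<Rightarrow> 'a \<Rightarrow> real" where
  "matern \<epsilon> w z = exp (- \<epsilon> * norm (w - z))"

definition gaussian :: "real \<Rightarrow> 'a::real_normed_vector \<Rightarrow> 'a \<Rightarrow> real" where
  "gaussian \<epsilon> w z = exp (- (\<epsilon>\<^sup>2) * (norm (w - z))\<^sup>2)"

text \<open>The point \<open>(w, \<Psi> w)\<close> of \<open>(d+m)\<close>-dimensional Euclidean space is rendered as an element of a
  product type; its norm is the Euclidean one by \<open>norm_Pair\<close>.\<close>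

definition scaled_point :: "('a \<Rightarrow> 'b) \<Rightarrow> 'a \<Rightarrow> 'a \<times> 'b" where
  "scaled_point \<Psi> w = (w, \<Psi> w)"

definition vs_matern ::
    "real \<Rightarrow> ('a::real_normed_vector \<Rightarrow> 'b::real_normed_vector) \<Rightarrow> 'a \<Rightarrow> 'a \<Rightarrow> real" where
  "vs_matern \<epsilon> \<Psi> w z = matern \<epsilon> (scaled_point \<Psi> w) (scaled_point \<Psi> z)"

definition kernel_matrix :: "('a \<Rightarrow> 'a \<Rightarrow> real) \<Rightarrow> ('n \<Rightarrow> 'a) \<Rightarrow> real^'n^'n" where
  "kernel_matrix k u = (\<chi> i j. k (u i) (u j))"

definition distance_matrix :: "('n \<Rightarrow> 'a::real_normed_vector) \<Rightarrow> real^'n^'n" where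
  "distance_matrix u = (\<chi> i j. norm (u i - u j))"

definition scale_minus_one :: "real \<Rightarrow> real^'n^'m \<Rightarrow> real^'n^'m" where
  "scale_minus_one \<epsilon> D = (\<chi> i j. \<epsilon> * D $ i $ j - 1)"

end

theory Submission imports Defs "HOL-Real_Asymp.Real_Asymp" begin

text \<open>
  Write \<open>d\<close> and \<open>r\<close> for the distances of two centres before and after they are lifted by \<open>\<Psi>\<close>, and
  \<open>h\<close> for the distance of their \<open>\<Psi>\<close>-values. By Pythagoras \<open>r\<^sup>2 = d\<^sup>2 + h\<^sup>2\<close>, so in the
  matrix \<open>B\<close> assumed to be positive definite the quadratic exponents cancel and its entries are
  \<open>exp (\<epsilon> * d - \<epsilon> * r)\<close>: \<open>B\<close> is the entrywise quotient of \<open>K\<Psi>\<close> by \<open>K\<close>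
  (\<open>variably_scaled_entry_identity\<close>). Hence \<open>K\<Psi>\<close> is the Hadamard product of \<open>K\<close> with a positive
  definite matrix whose diagonal is \<open>1\<close>.

  Such a product cannot worsen the condition number (\<open>cond_hadamard_le\<close>). If \<open>m\<close> and \<open>M\<close> are the
  extreme eigenvalues of \<open>K\<close>, then \<open>K - m I\<close> and \<open>M I - K\<close> are positive semidefinite. By the Schur
  product theorem (\<open>schur_product\<close>) they remain so after entrywise multiplication by \<open>B\<close>,
  and the unit diagonal of \<open>B\<close> leaves the multiples of \<open>I\<close> untouched. So the spectrum of \<open>K\<Psi>\<close> lies
  in \<open>[m, M]\<close> as well.

  Turning this into condition numbers requires \<open>m > 0\<close>, that is, strict positive definiteness of the
  kernel \<open>exp (- \<epsilon> * norm (w - z))\<close> (\<open>matern_strictly_pos_def\<close>). That kernel is a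
  superposition of Gaussians, with weights given by a classical integral
  (\<open>laplace_gaussian_mixture\<close>). Gaussians have nonnegative quadratic forms, and
  the very narrow ones in the mixture are close to the identity matrix, which gives strictness.
\<close>

section \<open>Gaussian kernels\<close>

definition quad_form :: "'i set \<Rightarrow> ('i \<Rightarrow> 'i \<Rightarrow> real) \<Rightarrow> ('i \<Rightarrow> real) \<Rightarrow> real" where
  "quad_form S A c = (\<Sum>i\<in>S. \<Sum>j\<in>S. c i * c j * A i j)"

text \<open>Expanding one inner product in coordinates writes the form for the exponent \<open>Suc k\<close> as a sum of
  forms for \<open>k\<close>, with weights multiplied by a coordinate of the points.\<close>
lemma quad_form_inner_power_nonneg:
  fixes x :: "'i \<Rightarrow> 'a::euclidean_space"
  shows "0 \<le> quad_form S (\<lambda>i j. (x i \<bullet> x j) ^ k) c"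
proof (induction k arbitrary: c)
  case 0
  have "quad_form S (\<lambda>i j. (x i \<bullet> x j) ^ 0) c = (\<Sum>i\<in>S. c i)\<^sup>2"
    by (simp add: quad_form_def power2_eq_square sum_product)
  then show ?case by simp
next
  case (Suc k)
  have "quad_form S (\<lambda>i j. (x i \<bullet> x j) ^ Suc k) c
      = (\<Sum>i\<in>S. \<Sum>j\<in>S. \<Sum>b\<in>Basis. (c i * (x i \<bullet> b)) * (c j * (x j \<bullet> b)) * (x i \<bullet> x j) ^ k)"
    unfolding quad_form_def
  proof (intro sum.cong refl)
    fix i j
    have "x i \<bullet> x j = (\<Sum>b\<in>Basis. (x i \<bullet> b) * (x j \<bullet> b))"
      by (rule euclidean_inner)
    then have "c i * c j * (x i \<bullet> x j) ^ Suc k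
        = c i * c j * (\<Sum>b\<in>Basis. (x i \<bullet> b) * (x j \<bullet> b)) * (x i \<bullet> x j) ^ k"
      by simp
    then show "c i * c j * (x i \<bullet> x j) ^ Suc k
        = (\<Sum>b\<in>Basis. (c i * (x i \<bullet> b)) * (c j * (x j \<bullet> b)) * (x i \<bullet> x j) ^ k)"
      by (simp add: sum_distrib_left sum_distrib_right mult_ac)
  qed
  also have "\<dots> = (\<Sum>i\<in>S. \<Sum>b\<in>Basis. \<Sum>j\<in>S. (c i * (x i \<bullet> b)) * (c j * (x j \<bullet> b)) * (x i \<bullet> x j) ^ k)"
    by (intro sum.cong refl sum.swap)
  also have "\<dots> = (\<Sum>b\<in>Basis. quad_form S (\<lambda>i j. (x i \<bullet> x j) ^ k) (\<lambda>i. c i * (x i \<bullet> b)))"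
    unfolding quad_form_def by (rule sum.swap)
  finally show ?case
    by (simp add: Suc.IH sum_nonneg)
qed

lemma quad_form_exp_inner_nonneg:
  fixes x :: "'i \<Rightarrow> 'a::euclidean_space"
  assumes "0 \<le> t"
  shows "0 \<le> quad_form S (\<lambda>i j. exp (t * (x i \<bullet> x j))) c"
proof -
  have exp_series: "(\<lambda>k. t ^ k / fact k * (r ^ k)) sums exp (t * r)" for r :: real
    using exp_converges[of "t * r"] by (simp add: power_mult_distrib divide_inverse mult_ac)
  have "(\<lambda>k. \<Sum>i\<in>S. \<Sum>j\<in>S. c i * c j * (t ^ k / fact k * (x i \<bullet> x j) ^ k))
      sums quad_form S (\<lambda>i j. exp (t * (x i \<bullet> x j))) c"
    unfolding quad_form_def by (intro sums_sum sums_mult exp_series)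
  moreover have "(\<lambda>k. \<Sum>i\<in>S. \<Sum>j\<in>S. c i * c j * (t ^ k / fact k * (x i \<bullet> x j) ^ k))
      = (\<lambda>k. t ^ k / fact k * quad_form S (\<lambda>i j. (x i \<bullet> x j) ^ k) c)"
    by (simp add: quad_form_def sum_distrib_left mult_ac)
  ultimately have sums: "(\<lambda>k. t ^ k / fact k * quad_form S (\<lambda>i j. (x i \<bullet> x j) ^ k) c)
      sums quad_form S (\<lambda>i j. exp (t * (x i \<bullet> x j))) c"
    by simp
  show ?thesis
    by (rule sums_le[OF _ sums_zero sums]) (simp add: assms quad_form_inner_power_nonneg)
qed

text \<open>Expanding the squared distance, the pure squares are absorbed into the weights and the
  exponential of an inner product remains; its power series has nonnegative coefficients.\<close>
lemma quad_form_gaussian_nonneg: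
  fixes x :: "'i \<Rightarrow> 'a::euclidean_space"
  assumes "0 \<le> t"
  shows "0 \<le> quad_form S (\<lambda>i j. exp (- t * (norm (x i - x j))\<^sup>2)) c"
proof -
  have dist: "(norm (x i - x j))\<^sup>2 = x i \<bullet> x i + x j \<bullet> x j - 2 * (x i \<bullet> x j)" for i j
    by (simp add: power2_norm_eq_inner inner_diff_left inner_diff_right inner_commute)
  have "exp (- t * (norm (x i - x j))\<^sup>2)
      = exp (- t * (x i \<bullet> x i)) * exp (- t * (x j \<bullet> x j)) * exp (2 * t * (x i \<bullet> x j))" for i j
    unfolding dist mult_exp_exp by (simp add: algebra_simps)
  then have "quad_form S (\<lambda>i j. exp (- t * (norm (x i - x j))\<^sup>2)) c
      = quad_form S (\<lambda>i j. exp (2 * t * (x i \<bullet> x j))) (\<lambda>i. c i * exp (- t * (x i \<bullet> x i)))"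
    by (simp add: quad_form_def mult_ac)
  then show ?thesis
    using quad_form_exp_inner_nonneg[of "2 * t"] assms by simp
qed

section \<open>The Laplace kernel as a mixture of Gaussians\<close>

text \<open>The error function up to normalisation. The value of \<open>L\<close> does not matter below: it only
  scales the mixture.\<close>
lemma gaussian_antiderivative:
  obtains E :: "real \<Rightarrow> real" and L :: real
  where "\<And>x. (E has_real_derivative exp (- x\<^sup>2)) (at x)" and "E 0 = 0" and "L > 0"
    and "(E \<longlongrightarrow> L) at_top" and "(E \<longlongrightarrow> - L) at_bot"
proof -
  have "\<exists>F. \<forall>x::real. -\<infinity> < ereal x \<longrightarrow> ereal x < \<infinity> \<longrightarrow> (F has_vector_derivative exp (- x\<^sup>2)) (at x)"
    by (rule einterval_antiderivative) (auto intro!: continuous_intros)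
  then obtain F :: "real \<Rightarrow> real" where F: "\<And>x. (F has_real_derivative exp (- x\<^sup>2)) (at x)"
    by (auto simp: has_real_derivative_iff_has_vector_derivative)
  define E where "E = (\<lambda>x. F x - F 0)"
  have E: "(E has_real_derivative exp (- x\<^sup>2)) (at x)" for x
    unfolding E_def by (auto intro!: derivative_eq_intros F)
  have E_comp [derivative_intros]:
    "((\<lambda>x. E (f x)) has_real_derivative exp (- (f x)\<^sup>2) * f') (at x)"
    if "(f has_real_derivative f') (at x)" for f f' x
    using DERIV_chain2[OF E that] .
  have E0: "E 0 = 0" by (simp add: E_def)
  have strict: "E x < E y" if "x < y" for x y
    by (rule DERIV_pos_imp_increasing[OF that]) (use E exp_gt_zero in blast)
  then have "mono E"
    by (intro monoI) (metis order_le_less)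
  have odd: "E (- x) = - E x" for x
  proof -
    have "E x + E (- x) = E 0 + E (- 0)"
      by (rule DERIV_isconst_all) (auto intro!: derivative_eq_intros E)
    then show ?thesis using E0 by simp
  qed
  \<comment> \<open>Since \<open>exp (- y\<^sup>2) \<le> 1 / (1 + y\<^sup>2)\<close>, the arctangent grows at least as fast as \<open>E\<close>.\<close>
  have bound: "E x \<le> pi / 2" if "0 \<le> x" for x
  proof -
    have "E x - arctan x \<le> E 0 - arctan 0"
    proof (rule DERIV_nonpos_imp_nonincreasing[OF that])
      fix y :: real
      have "exp (- y\<^sup>2) - inverse (1 + y\<^sup>2) \<le> 0"
        using exp_ge_add_one_self[of "y\<^sup>2"] by (simp add: exp_minus add_pos_nonneg)
      moreover have "((\<lambda>x. E x - arctan x) has_real_derivative exp (- y\<^sup>2) - inverse (1 + y\<^sup>2)) (at y)"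
        by (auto intro!: derivative_eq_intros E)
      ultimately show "\<exists>z. ((\<lambda>x. E x - arctan x) has_real_derivative z) (at y) \<and> z \<le> 0"
        by blast
    qed
    then show ?thesis using arctan_ubound[of x] E0 by simp
  qed
  obtain L where L: "(\<lambda>n. E (real n)) \<longlonglongrightarrow> L" and le_L: "\<And>n. E (real n) \<le> L"
  proof (rule incseq_convergent)
    show "incseq (\<lambda>n. E (real n))" using \<open>mono E\<close> by (simp add: incseq_def monoD)
    show "\<forall>n. E (real n) \<le> pi / 2" by (intro allI bound) simp
  qed auto
  have top: "(E \<longlongrightarrow> L) at_top"
    by (rule tendsto_at_topI_sequentially_real[OF \<open>mono E\<close> L])
  have "((\<lambda>x. - E (- x)) \<longlongrightarrow> - L) at_bot"
    by (intro tendsto_minus filterlim_compose[OF top] filterlim_uminus_at_top_at_bot)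
  then have bot: "(E \<longlongrightarrow> - L) at_bot" by (simp add: odd)
  have "L > 0" using strict[of 0 1] le_L[of 1] E0 by simp
  from that[OF E E0 this top bot] show thesis .
qed

text \<open>For \<open>a = \<epsilon> * d / 2\<close> the integrand is, at each fixed \<open>x\<close>, a Gaussian in the distance \<open>d\<close>, and the
  integral is a multiple of \<open>exp (- \<epsilon> * d)\<close>. The integral is elementary in terms of \<open>E\<close>, because
  \<open>- x\<^sup>2 - a\<^sup>2 / x\<^sup>2\<close> is both \<open>- (x - a / x)\<^sup>2 - 2 * a\<close> and \<open>- (x + a / x)\<^sup>2 + 2 * a\<close>, while the
  derivatives \<open>1 + a / x\<^sup>2\<close> and \<open>1 - a / x\<^sup>2\<close> of the two inner functions add up to \<open>2\<close>.\<close>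
lemma laplace_gaussian_mixture:
  obtains L :: real where "L > 0"
    and "\<And>a. 0 \<le> a \<Longrightarrow> has_bochner_integral lborel
           (\<lambda>x. indicat_real {0<..} x * exp (- x\<^sup>2 - a\<^sup>2 / x\<^sup>2)) (L * exp (- 2 * a))"
proof -
  obtain E :: "real \<Rightarrow> real" and L :: real
    where E: "\<And>x. (E has_real_derivative exp (- x\<^sup>2)) (at x)" and E0: "E 0 = 0" and "L > 0"
      and top: "(E \<longlongrightarrow> L) at_top" and bot: "(E \<longlongrightarrow> - L) at_bot"
    using gaussian_antiderivative by blast
  have E_comp [derivative_intros]:
    "((\<lambda>x. E (f x)) has_real_derivative exp (- (f x)\<^sup>2) * f') (at x)"
    if "(f has_real_derivative f') (at x)" for f f' x
    using DERIV_chain2[OF E that] .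
  have "has_bochner_integral lborel
           (\<lambda>x. indicat_real {0<..} x * exp (- x\<^sup>2 - a\<^sup>2 / x\<^sup>2)) (L * exp (- 2 * a))"
    if "0 \<le> a" for a
  proof -
    define f where "f = (\<lambda>x::real. exp (- x\<^sup>2 - a\<^sup>2 / x\<^sup>2))"
    define F where "F = (\<lambda>x. (exp (- 2 * a) * E (x - a / x) + exp (2 * a) * E (x + a / x)) / 2)"
    \<comment> \<open>The limits of \<open>F\<close> at \<open>0\<close> and at infinity. At \<open>0\<close> the terms \<open>a / x\<close> diverge unless \<open>a = 0\<close>,
      which must be treated separately because the diagonal of the kernel matrix needs it.\<close>
    define A where "A = (if a = 0 then 0 else (exp (2 * a) * L - exp (- 2 * a) * L) / 2)"
    define B where "B = (exp (- 2 * a) * L + exp (2 * a) * L) / 2"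
    have deriv: "(F has_real_derivative f x) (at x)" if "x > 0" for x
    proof -
      have e1: "exp (- 2 * a) * exp (- (x - a / x)\<^sup>2) = f x"
        and e2: "exp (2 * a) * exp (- (x + a / x)\<^sup>2) = f x"
        unfolding f_def mult_exp_exp using that by (simp_all add: power2_eq_square field_simps)
      have "(F has_real_derivative
          (exp (- 2 * a) * (exp (- (x - a / x)\<^sup>2) * (1 + a / x\<^sup>2))
            + exp (2 * a) * (exp (- (x + a / x)\<^sup>2) * (1 - a / x\<^sup>2))) / 2) (at x)"
        unfolding F_def using that
        by (auto intro!: derivative_eq_intros simp: power2_eq_square)
      moreover have "(exp (- 2 * a) * (exp (- (x - a / x)\<^sup>2) * (1 + a / x\<^sup>2))
            + exp (2 * a) * (exp (- (x + a / x)\<^sup>2) * (1 - a / x\<^sup>2))) / 2 = f x"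
        unfolding mult.assoc[symmetric] e1 e2 by (simp add: algebra_simps)
      ultimately show ?thesis by simp
    qed
    have limA: "(F \<longlongrightarrow> A) (at_right 0)"
    proof (cases "a = 0")
      case True
      have "isCont E 0" using E DERIV_isCont by blast
      then have "(E \<longlongrightarrow> 0) (at_right 0)"
        using E0 by (metis isCont_def filterlim_at_split)
      then show ?thesis using True by (simp add: F_def A_def)
    next
      case False
      with that have "a > 0" by simp
      have "filterlim (\<lambda>x. x + a / x) at_top (at_right 0)"
        and "filterlim (\<lambda>x. x - a / x) at_bot (at_right 0)"
        using \<open>a > 0\<close> by real_asymp+
      then have "((\<lambda>x. E (x + a / x)) \<longlongrightarrow> L) (at_right 0)"
        and "((\<lambda>x. E (x - a / x)) \<longlongrightarrow> - L) (at_right 0)"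
        using filterlim_compose top bot by blast+
      then have "(F \<longlongrightarrow> (exp (- 2 * a) * (- L) + exp (2 * a) * L) / 2) (at_right 0)"
        unfolding F_def by (intro tendsto_intros) auto
      then show ?thesis using False by (simp add: A_def algebra_simps)
    qed
    have limB: "(F \<longlongrightarrow> B) at_top"
    proof -
      have "filterlim (\<lambda>x. x + a / x) at_top at_top"
        and "filterlim (\<lambda>x. x - a / x) at_top at_top"
        by real_asymp+
      then have "((\<lambda>x. E (x + a / x)) \<longlongrightarrow> L) at_top"
        and "((\<lambda>x. E (x - a / x)) \<longlongrightarrow> L) at_top"
        using filterlim_compose top by blast+
      then show ?thesis
        unfolding F_def B_def by (intro tendsto_intros) auto
    qed
    have tends0: "((F \<circ> real_of_ereal) \<longlongrightarrow> A) (at_right (ereal 0))"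
      using limA by (simp add: ereal_tendsto_simps)
    have tends_inf: "((F \<circ> real_of_ereal) \<longlongrightarrow> B) (at_left \<infinity>)"
      using limB by (simp add: ereal_tendsto_simps)
    have cont: "isCont f x" if "ereal 0 < ereal x" for x
      unfolding f_def using that by (auto intro!: continuous_intros)
    have nonneg: "AE x in lborel. ereal 0 < ereal x \<longrightarrow> ereal x < \<infinity> \<longrightarrow> 0 \<le> f x"
      by (simp add: f_def)
    note FTC = interval_integral_FTC_nonneg[OF _ _ cont nonneg tends0 tends_inf]
    have "set_integrable lborel (einterval (ereal 0) \<infinity>) f"
      by (rule FTC(1)) (auto intro: deriv)
    moreover have "(LBINT x=ereal 0..\<infinity>. f x) = B - A"
      by (rule FTC(2)) (auto intro: deriv)
    moreover have "B - A = L * exp (- 2 * a)"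
      by (simp add: A_def B_def field_simps)
    ultimately show ?thesis
      unfolding f_def[symmetric]
      by (simp add: has_bochner_integral_iff set_integrable_def interval_lebesgue_integral_def
          set_lebesgue_integral_def f_def)
  qed
  with \<open>L > 0\<close> show thesis using that by blast
qed

text \<open>The quadratic form of the kernel is an integral over \<open>y > 0\<close> of the nonnegative Gaussian forms
  \<open>q y\<close>, weighted by \<open>exp (- y\<^sup>2)\<close>. As \<open>y\<close> tends to \<open>0\<close> the Gaussian matrix of distinct points tends to the
  identity, so \<open>q y\<close> tends to the positive sum of the squared weights, and the integrand
  is bounded away from \<open>0\<close> on a whole interval.\<close>
lemma matern_strictly_pos_def:
  fixes x :: "'i \<Rightarrow> 'a::euclidean_space"
  assumes "finite S" and "inj_on x S" and "\<epsilon> > 0" and "k \<in> S" and "c k \<noteq> 0"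
  shows "0 < quad_form S (\<lambda>i j. matern \<epsilon> (x i) (x j)) c"
proof -
  obtain L :: real where "L > 0"
    and mixture: "\<And>a. 0 \<le> a \<Longrightarrow> has_bochner_integral lborel
           (\<lambda>x. indicat_real {0<..} x * exp (- x\<^sup>2 - a\<^sup>2 / x\<^sup>2)) (L * exp (- 2 * a))"
    using laplace_gaussian_mixture by blast
  define a where "a = (\<lambda>i j. \<epsilon> * norm (x i - x j) / 2)"
  have a_nonneg: "0 \<le> a i j" for i j using \<open>\<epsilon> > 0\<close> by (simp add: a_def)
  have a_zero: "a i j = 0 \<longleftrightarrow> i = j" if "i \<in> S" "j \<in> S" for i j
    using that assms by (auto simp: a_def inj_on_def)
  define q where "q = (\<lambda>y::real. quad_form S (\<lambda>i j. exp (- (a i j)\<^sup>2 / y\<^sup>2)) c)"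
  have q_nonneg: "0 \<le> q y" for y
  proof -
    have "q y = quad_form S (\<lambda>i j. exp (- (\<epsilon>\<^sup>2 / (4 * y\<^sup>2)) * (norm (x i - x j))\<^sup>2)) c"
      by (simp add: q_def a_def power_mult_distrib power_divide)
    then show ?thesis
      using quad_form_gaussian_nonneg[of "\<epsilon>\<^sup>2 / (4 * y\<^sup>2)" S x c] by simp
  qed
  define s where "s = (\<Sum>i\<in>S. (c i)\<^sup>2)"
  have "s > 0"
    unfolding s_def using assms by (intro sum_pos2[where i = k]) auto
  have "(q \<longlongrightarrow> (\<Sum>i\<in>S. \<Sum>j\<in>S. c i * c j * (if i = j then 1 else 0))) (at_right 0)"
    unfolding q_def quad_form_def
  proof (intro tendsto_intros)
    fix i j assume "i \<in> S" "j \<in> S"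
    show "((\<lambda>y. exp (- (a i j)\<^sup>2 / y\<^sup>2)) \<longlongrightarrow> (if i = j then 1 else 0)) (at_right 0)"
    proof (cases "i = j")
      case True
      then show ?thesis using a_zero[OF \<open>i \<in> S\<close> \<open>j \<in> S\<close>] by simp
    next
      case False
      then have "a i j > 0"
        using a_zero[OF \<open>i \<in> S\<close> \<open>j \<in> S\<close>] a_nonneg[of i j] by simp
      then have "((\<lambda>y. exp (- (a i j)\<^sup>2 / y\<^sup>2)) \<longlongrightarrow> 0) (at_right 0)"
        by real_asymp
      then show ?thesis using False by simp
    qed
  qed
  moreover have "(\<Sum>i\<in>S. \<Sum>j\<in>S. c i * c j * (if i = j then 1 else 0)) = s"
    using \<open>finite S\<close> by (simp add: s_def power2_eq_square if_distrib cong: if_cong)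
  ultimately have "eventually (\<lambda>y. s / 2 < q y) (at_right 0)"
    using \<open>s > 0\<close> by (intro order_tendstoD(1)) auto
  then obtain \<delta> where "\<delta> > 0" and \<delta>: "\<And>y. 0 < y \<Longrightarrow> y < \<delta> \<Longrightarrow> s / 2 < q y"
    by (auto simp: eventually_at_right_field)
  have int_q: "has_bochner_integral lborel (\<lambda>y. indicat_real {0<..} y * (exp (- y\<^sup>2) * q y))
      (L * quad_form S (\<lambda>i j. matern \<epsilon> (x i) (x j)) c)"
  proof -
    have "has_bochner_integral lborel
       (\<lambda>y. \<Sum>i\<in>S. \<Sum>j\<in>S. c i * c j * (indicat_real {0<..} y * exp (- y\<^sup>2 - (a i j)\<^sup>2 / y\<^sup>2)))
       (\<Sum>i\<in>S. \<Sum>j\<in>S. c i * c j * (L * exp (- 2 * a i j)))"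
      by (intro has_bochner_integral_sum has_bochner_integral_mult_right mixture a_nonneg)
    moreover have "(\<lambda>y. \<Sum>i\<in>S. \<Sum>j\<in>S. c i * c j * (indicat_real {0<..} y * exp (- y\<^sup>2 - (a i j)\<^sup>2 / y\<^sup>2)))
        = (\<lambda>y. indicat_real {0<..} y * (exp (- y\<^sup>2) * q y))"
      by (simp add: q_def quad_form_def sum_distrib_left exp_diff exp_minus divide_inverse mult_ac)
    moreover have "(\<Sum>i\<in>S. \<Sum>j\<in>S. c i * c j * (L * exp (- 2 * a i j)))
        = L * quad_form S (\<lambda>i j. matern \<epsilon> (x i) (x j)) c"
      by (simp add: quad_form_def matern_def a_def sum_distrib_left mult_ac)
    ultimately show ?thesis by simp
  qed
  define h where "h = (\<lambda>y. indicat_real {0<..<\<delta>} y * (exp (- \<delta>\<^sup>2) * (s / 2)))"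
  have int_h: "has_bochner_integral lborel h (\<delta> * (exp (- \<delta>\<^sup>2) * (s / 2)))"
    unfolding h_def
    using \<open>\<delta> > 0\<close> has_bochner_integral_real_indicator[of "{0<..<\<delta>}" lborel]
    by (intro has_bochner_integral_mult_left) auto
  have "\<delta> * (exp (- \<delta>\<^sup>2) * (s / 2)) \<le> L * quad_form S (\<lambda>i j. matern \<epsilon> (x i) (x j)) c"
    unfolding has_bochner_integral_integral_eq[OF int_h, symmetric]
      has_bochner_integral_integral_eq[OF int_q, symmetric]
  proof (rule integral_mono)
    show "integrable lborel h"
      and "integrable lborel (\<lambda>y. indicat_real {0<..} y * (exp (- y\<^sup>2) * q y))"
      using int_h int_q by (auto simp: has_bochner_integral_iff)
    fix y
    have "exp (- \<delta>\<^sup>2) * (s / 2) \<le> exp (- y\<^sup>2) * q y" if "0 < y" "y < \<delta>"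
      using that \<delta>[OF that] \<open>s > 0\<close> by (intro mult_mono) (auto simp: power_mono)
    then show "h y \<le> indicat_real {0<..} y * (exp (- y\<^sup>2) * q y)"
      using q_nonneg[of y] by (auto simp: h_def indicator_def)
  qed
  moreover have "0 < \<delta> * (exp (- \<delta>\<^sup>2) * (s / 2))"
    using \<open>\<delta> > 0\<close> \<open>s > 0\<close> by simp
  ultimately show ?thesis
    using \<open>L > 0\<close> by (meson less_le_trans zero_less_mult_pos)
qed
section \<open>The Schur product theorem\<close>

lemma linear_coeff_zero_if_quadratic_nonneg:
  fixes a b :: real
  assumes nonneg: "\<And>t. 0 \<le> 2 * t * b + t\<^sup>2 * a"
  shows "b = 0"
proof (rule ccontr)
  assume "b \<noteq> 0"
  have "a \<ge> 0" using nonneg[of 1] nonneg[of "-1"] by simp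
  \<comment> \<open>The minimiser would be \<open>- b / a\<close>; enlarging the denominator covers \<open>a = 0\<close> too.\<close>
  have "2 * (- b / (a + 1)) * b + (- b / (a + 1))\<^sup>2 * a = - (b\<^sup>2 * (a + 2)) / (a + 1)\<^sup>2"
    using \<open>a \<ge> 0\<close> by (simp add: power2_eq_square divide_simps) (simp add: algebra_simps)
  also have "\<dots> < 0"
    using \<open>a \<ge> 0\<close> \<open>b \<noteq> 0\<close> by (intro divide_neg_pos) (auto simp: mult_pos_pos)
  finally show False
    using nonneg[of "- b / (a + 1)"] by simp
qed

definition psd_kernel :: "'i set \<Rightarrow> ('i \<Rightarrow> 'i \<Rightarrow> real) \<Rightarrow> bool" where
  "psd_kernel S A \<longleftrightarrow> (\<forall>i\<in>S. \<forall>j\<in>S. A i j = A j i) \<and> (\<forall>c. 0 \<le> quad_form S A c)"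

lemma quad_form_insert:
  assumes "finite S" and "p \<notin> S" and sym: "\<And>i. i \<in> S \<Longrightarrow> A i p = A p i"
  shows "quad_form (insert p S) A c
    = (c p)\<^sup>2 * A p p + 2 * c p * (\<Sum>i\<in>S. c i * A p i) + quad_form S A c"
proof -
  have "(\<Sum>i\<in>S. c i * c p * A i p) = c p * (\<Sum>i\<in>S. c i * A p i)"
    by (simp add: sum_distrib_left sym mult_ac)
  moreover have "(\<Sum>i\<in>S. c p * c i * A p i) = c p * (\<Sum>i\<in>S. c i * A p i)"
    by (simp add: sum_distrib_left mult_ac)
  ultimately show ?thesis
    using assms(1,2) by (simp add: quad_form_def sum.distrib power2_eq_square)
qed

lemma quad_form_cong:
  assumes "\<And>i. i \<in> S \<Longrightarrow> c i = d i" and "\<And>i j. i \<in> S \<Longrightarrow> j \<in> S \<Longrightarrow> A i j = B i j"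
  shows "quad_form S A c = quad_form S B d"
  unfolding quad_form_def by (intro sum.cong refl) (simp add: assms)

lemma psd_kernel_subset:
  assumes "psd_kernel T A" and "S \<subseteq> T" and "finite T"
  shows "psd_kernel S A"
  unfolding psd_kernel_def
proof (intro conjI allI)
  show "\<forall>i\<in>S. \<forall>j\<in>S. A i j = A j i"
    using assms unfolding psd_kernel_def by blast
  fix c
  have "quad_form S A c = quad_form T A (\<lambda>i. if i \<in> S then c i else 0)"
    unfolding quad_form_def using assms(2,3)
    by (intro sum.mono_neutral_cong_left ballI sum.mono_neutral_cong_left) auto
  then show "0 \<le> quad_form S A c"
    using assms(1) by (simp add: psd_kernel_def)
qed

text \<open>With a zero at \<open>(p, p)\<close>, the form restricted to \<open>p\<close> and \<open>j\<close> has no square term in the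
  coefficient at \<open>p\<close>, so a mixed term could make it negative.\<close>
lemma psd_kernel_pivot_zero:
  assumes "psd_kernel S A" and "finite S" and "p \<in> S" and "j \<in> S" and "A p p = 0"
  shows "A p j = 0"
proof (cases "j = p")
  case False
  have psd: "psd_kernel {p, j} A"
    by (rule psd_kernel_subset[OF assms(1)]) (simp_all add: assms)
  then have "A j p = A p j" unfolding psd_kernel_def by blast
  then have form: "quad_form {p, j} A (\<lambda>i. if i = p then 1 else t) = 2 * t * A p j + t\<^sup>2 * A j j" for t
    using False assms(5) by (simp add: quad_form_def power2_eq_square)
  have "0 \<le> 2 * t * A p j + t\<^sup>2 * A j j" for t
    unfolding form[symmetric] using psd by (simp only: psd_kernel_def)
  then show ?thesis
    by (rule linear_coeff_zero_if_quadratic_nonneg)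
qed (use assms in simp)

text \<open>The Schur complement is the form that remains after minimising over the coefficient at the
  pivot \<open>p\<close>. A zero pivot is harmless: then the quotient vanishes by convention and \<open>A\<close> itself is
  restricted to \<open>S\<close>.\<close>
lemma psd_kernel_schur_complement:
  assumes psd: "psd_kernel (insert p S) A" and "finite S" and "p \<notin> S"
  shows "psd_kernel S (\<lambda>i j. A i j - A p i * A p j / A p p)"
  unfolding psd_kernel_def
proof (intro conjI allI)
  have sym: "A i j = A j i" if "i \<in> insert p S" "j \<in> insert p S" for i j
    using psd that by (auto simp: psd_kernel_def)
  then show "\<forall>i\<in>S. \<forall>j\<in>S. A i j - A p i * A p j / A p p = A j i - A p j * A p i / A p p"
    by simp
  fix c
  define b where "b = (\<Sum>i\<in>S. c i * A p i)"
  \<comment> \<open>The coefficient at \<open>p\<close> that minimises the quadratic form of \<open>A\<close> with the others fixed.\<close>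
  define d where "d = c(p := - b / A p p)"
  have "quad_form S (\<lambda>i j. A i j - A p i * A p j / A p p) c
      = quad_form S A c - (\<Sum>i\<in>S. \<Sum>j\<in>S. (c i * A p i) * (c j * A p j) / A p p)"
    by (simp add: quad_form_def algebra_simps sum_subtractf)
  also have "(\<Sum>i\<in>S. \<Sum>j\<in>S. (c i * A p i) * (c j * A p j) / A p p) = b\<^sup>2 / A p p"
    by (simp add: b_def power2_eq_square sum_product sum_divide_distrib)
  also have "quad_form S A c - b\<^sup>2 / A p p = quad_form (insert p S) A d"
  proof -
    have "quad_form S A d = quad_form S A c" and "(\<Sum>i\<in>S. d i * A p i) = b"
      using \<open>p \<notin> S\<close> by (auto simp: d_def b_def intro!: quad_form_cong sum.cong)
    then have "quad_form (insert p S) A d = (d p)\<^sup>2 * A p p + 2 * d p * b + quad_form S A c"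
      using quad_form_insert[of S p A d] assms(2,3) sym by simp
    moreover have "(d p)\<^sup>2 * A p p + 2 * d p * b = - b\<^sup>2 / A p p"
      by (cases "A p p = 0") (simp_all add: d_def power2_eq_square)
    ultimately show ?thesis by simp
  qed
  also have "0 \<le> \<dots>" using psd by (simp add: psd_kernel_def)
  finally show "0 \<le> quad_form S (\<lambda>i j. A i j - A p i * A p j / A p p) c" .
qed

text \<open>One step of symmetric Gaussian elimination splits \<open>A\<close> into the rank-one kernel
  \<open>A p i * A p j / A p p\<close> and the Schur complement \<open>A'\<close>. Multiplied entrywise by \<open>B\<close>, the former gives a
  rescaled form of \<open>B\<close>, and the latter lives on \<open>S\<close>, where induction applies. Gaussian
  elimination replaces the spectral decomposition of the usual proof.\<close>
theorem schur_product:
  assumes "finite S" and "psd_kernel S A" and "psd_kernel S B"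
  shows "0 \<le> quad_form S (\<lambda>i j. A i j * B i j) c"
  using assms
proof (induction S arbitrary: A)
  case empty
  then show ?case by (simp add: quad_form_def)
next
  case (insert p S)
  define A' where "A' = (\<lambda>i j. A i j - A p i * A p j / A p p)"
  have sym: "A i j = A j i" if "i \<in> insert p S" "j \<in> insert p S" for i j
    using insert.prems that by (auto simp: psd_kernel_def)
  have symB: "B i j = B j i" if "i \<in> insert p S" "j \<in> insert p S" for i j
    using insert.prems that by (auto simp: psd_kernel_def)
  have A'p: "A' p j = 0" if "j \<in> insert p S" for j
    using psd_kernel_pivot_zero[of "insert p S" A p j] insert that
    by (cases "A p p = 0") (simp_all add: A'_def)
  have A'sym: "A' i j = A' j i" if "i \<in> insert p S" "j \<in> insert p S" for i j
    using sym[OF that] by (simp add: A'_def)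
  have "A p p \<ge> 0"
    using psd_kernel_subset[OF insert.prems(1), of "{p}"] insert.hyps
    by (auto simp: psd_kernel_def quad_form_def dest: spec[of _ "\<lambda>_. 1"])
  have "quad_form (insert p S) (\<lambda>i j. A i j * B i j) c
      = quad_form (insert p S) B (\<lambda>i. c i * A p i) / A p p
        + quad_form (insert p S) (\<lambda>i j. A' i j * B i j) c"
    unfolding quad_form_def A'_def sum_divide_distrib sum.distrib[symmetric]
    by (intro sum.cong refl) (simp add: algebra_simps)
  also have "quad_form (insert p S) (\<lambda>i j. A' i j * B i j) c
      = quad_form S (\<lambda>i j. A' i j * B i j) c"
    using insert.hyps A'p A'sym symB by (subst quad_form_insert) (auto simp: mult_ac)
  also have "0 \<le> quad_form S (\<lambda>i j. A' i j * B i j) c"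
    using insert.IH psd_kernel_schur_complement[of p S A] insert.prems insert.hyps
      psd_kernel_subset[OF insert.prems(2), of S]
    by (auto simp: A'_def)
  moreover have "0 \<le> quad_form (insert p S) B (\<lambda>i. c i * A p i) / A p p"
    using \<open>A p p \<ge> 0\<close> insert.prems(2) by (simp add: psd_kernel_def)
  ultimately show ?case by linarith
qed

section \<open>Spectral bounds for Hadamard products\<close>

lemma inner_matrix_vector_eq_quad_form:
  fixes A :: "real^'n^'n"
  shows "x \<bullet> (A *v x) = quad_form UNIV (\<lambda>i j. A $ i $ j) (\<lambda>i. x $ i)"
proof -
  have "x \<bullet> (A *v x) = (\<Sum>i\<in>UNIV. \<Sum>j\<in>UNIV. x $ i * (A $ i $ j * x $ j))"
    by (simp add: inner_vec_def matrix_vector_mult_def sum_distrib_left)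
  also have "\<dots> = quad_form UNIV (\<lambda>i j. A $ i $ j) (\<lambda>i. x $ i)"
    unfolding quad_form_def by (intro sum.cong refl) (simp only: mult_ac)
  finally show ?thesis .
qed

lemma inner_matrix_vector_swap:
  fixes A :: "real^'n^'n"
  assumes "transpose A = A"
  shows "x \<bullet> (A *v y) = y \<bullet> (A *v x)"
proof -
  have "x \<bullet> (A *v y) = (transpose A *v x) \<bullet> y"
    by (simp only: transpose_matrix_vector dot_lmul_matrix)
  then show ?thesis
    by (simp only: assms inner_commute[of "A *v x" y])
qed

text \<open>The Schur product theorem for \<open>A - m I\<close> and \<open>B\<close>: since \<open>B\<close> has unit diagonal, its entrywise
  product with \<open>m I\<close> is again \<open>m I\<close>.\<close>
lemma inner_hadamard_ge:
  fixes A B :: "real^'n^'n"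
  assumes symA: "transpose A = A" and A: "\<And>x. m * (x \<bullet> x) \<le> x \<bullet> (A *v x)"
    and symB: "transpose B = B" and B: "\<And>x. 0 \<le> x \<bullet> (B *v x)" and diag: "\<And>i. B $ i $ i = 1"
  shows "m * (x \<bullet> x) \<le> x \<bullet> ((A \<circ>\<^sub>H B) *v x)"
proof -
  define A' where "A' = A - m *\<^sub>R mat 1"
  have entry: "A' $ i $ j = A $ i $ j - m * (if i = j then 1 else 0)" for i j
    by (simp add: A'_def mat_def)
  have shift: "x \<bullet> (A' *v x) = x \<bullet> (A *v x) - m * (x \<bullet> x)" for x
    by (simp add: A'_def matrix_vector_mult_diff_rdistrib scaleR_matrix_vector_assoc[symmetric]
        inner_diff_right)
  have vec: "0 \<le> quad_form UNIV (\<lambda>i j. C $ i $ j) c" if "\<And>x. 0 \<le> x \<bullet> (C *v x)"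
    for C :: "real^'n^'n" and c
    using that[of "\<chi> i. c i"] by (simp add: inner_matrix_vector_eq_quad_form)
  have sym: "C $ i $ j = C $ j $ i" if "transpose C = C" for C :: "real^'n^'n" and i j
  proof -
    have "C $ i $ j = transpose C $ i $ j" by (simp only: that)
    then show ?thesis by (simp add: transpose_def)
  qed
  have "psd_kernel UNIV (\<lambda>i j. A' $ i $ j)"
    unfolding psd_kernel_def
  proof (intro conjI ballI allI vec)
    show "A' $ i $ j = A' $ j $ i" for i j using sym[OF symA] by (simp add: entry)
    show "0 \<le> x \<bullet> (A' *v x)" for x using A by (simp add: shift)
  qed
  moreover have "psd_kernel UNIV (\<lambda>i j. B $ i $ j)"
    unfolding psd_kernel_def by (intro conjI ballI allI vec B sym[OF symB])
  ultimately have "0 \<le> quad_form UNIV (\<lambda>i j. A' $ i $ j * B $ i $ j) (\<lambda>i. x $ i)"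
    by (intro schur_product) auto
  also have "\<dots> = x \<bullet> ((A \<circ>\<^sub>H B) *v x) - (\<Sum>i\<in>UNIV. \<Sum>j\<in>UNIV. x $ i * x $ j * (m * (if i = j then 1 else 0) * B $ i $ j))"
    unfolding inner_matrix_vector_eq_quad_form quad_form_def sum_subtractf[symmetric]
    by (intro sum.cong refl) (simp add: entry hadamard_def algebra_simps)
  also have "(\<Sum>i\<in>UNIV. \<Sum>j\<in>UNIV. x $ i * x $ j * (m * (if i = j then 1 else 0) * B $ i $ j)) = m * (x \<bullet> x)"
  proof -
    have "x $ i * x $ j * (m * (if i = j then 1 else 0) * B $ i $ j)
        = (if i = j then m * (x $ i * x $ i) else 0)" for i j
      by (simp add: diag)
    then show ?thesis
      by (simp add: inner_vec_def sum_distrib_left)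
  qed
  finally show ?thesis by simp
qed

lemma inner_hadamard_le:
  fixes A B :: "real^'n^'n"
  assumes symA: "transpose A = A" and A: "\<And>x. x \<bullet> (A *v x) \<le> M * (x \<bullet> x)"
    and symB: "transpose B = B" and B: "\<And>x. 0 \<le> x \<bullet> (B *v x)" and diag: "\<And>i. B $ i $ i = 1"
  shows "x \<bullet> ((A \<circ>\<^sub>H B) *v x) \<le> M * (x \<bullet> x)"
proof -
  have neg: "(- C) *v y = - (C *v y)" for C :: "real^'n^'n" and y
    by (simp add: vec_eq_iff matrix_vector_mult_def sum_negf)
  have "transpose (- A) = - A"
    using symA by (simp add: transpose_def vec_eq_iff)
  then have "(- M) * (x \<bullet> x) \<le> x \<bullet> ((- A \<circ>\<^sub>H B) *v x)"
    using A by (intro inner_hadamard_ge symB B diag) (simp_all add: neg)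
  moreover have "- A \<circ>\<^sub>H B = - (A \<circ>\<^sub>H B)"
    by (simp add: hadamard_def vec_eq_iff)
  ultimately show ?thesis by (simp add: neg)
qed

section \<open>Quadratic forms and condition numbers\<close>

text \<open>A minimiser of the quadratic form on the compact unit sphere is an eigenvector. This yields as
  much of the spectral theorem as is needed to pass between eigenvalues and quadratic forms.\<close>
lemma min_rayleigh_quotient_eigenvector:
  fixes A :: "real^'n^'n"
  assumes sym: "transpose A = A"
  obtains c v where "v \<noteq> 0" and "A *v v = c *s v" and "\<And>x. c * (x \<bullet> x) \<le> x \<bullet> (A *v x)"
proof -
  have "sphere (0::real^'n) 1 \<noteq> {}" by simp
  moreover have "continuous_on (sphere 0 1) (\<lambda>x. x \<bullet> (A *v x))"
    by (intro continuous_on_inner continuous_on_id linear_continuous_on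
        matrix_vector_mul_bounded_linear)
  ultimately obtain v where v: "norm v = 1"
    and min: "\<And>y. norm y = 1 \<Longrightarrow> v \<bullet> (A *v v) \<le> y \<bullet> (A *v y)"
    using continuous_attains_inf[of "sphere 0 1" "\<lambda>x. x \<bullet> (A *v x)"] by auto
  define c where "c = v \<bullet> (A *v v)"
  have le: "c * (x \<bullet> x) \<le> x \<bullet> (A *v x)" for x
  proof (cases "x = 0")
    case False
    have "c \<le> sgn x \<bullet> (A *v sgn x)"
      using min[of "sgn x"] False by (simp add: c_def norm_sgn)
    also have "\<dots> = (x \<bullet> (A *v x)) / (norm x)\<^sup>2"
      by (simp add: sgn_div_norm matrix_vector_mult_scaleR power2_eq_square field_simps)
    finally show ?thesis
      using False by (simp add: power2_norm_eq_inner field_simps)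
  qed simp
  define r where "r = A *v v - c *\<^sub>R v"
  \<comment> \<open>First-order condition at the minimiser, in the direction of the residual.\<close>
  have "r \<bullet> r = 0"
  proof (rule linear_coeff_zero_if_quadratic_nonneg)
    fix t
    have "v \<bullet> (A *v r) = r \<bullet> (A *v v)"
      by (rule inner_matrix_vector_swap[OF sym])
    moreover have "r \<bullet> (A *v v) = r \<bullet> r + c * (r \<bullet> v)"
      by (simp add: r_def inner_diff_left inner_diff_right algebra_simps)
    moreover have "v \<bullet> v = 1" using v by (simp add: norm_eq_1)
    moreover have "c * ((v + t *\<^sub>R r) \<bullet> (v + t *\<^sub>R r)) \<le> (v + t *\<^sub>R r) \<bullet> (A *v (v + t *\<^sub>R r))"
      by (rule le)
    ultimately show "0 \<le> 2 * t * (r \<bullet> r) + t\<^sup>2 * (r \<bullet> (A *v r) - c * (r \<bullet> r))"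
      by (simp add: matrix_vector_right_distrib matrix_vector_mult_scaleR inner_add_left
          inner_add_right c_def[symmetric] inner_commute[of v r] power2_eq_square algebra_simps)
  qed
  then have "A *v v = c *s v"
    by (simp add: r_def scalar_mult_eq_scaleR)
  have "v \<noteq> 0" using v by auto
  from that[OF this \<open>A *v v = c *s v\<close> le] show thesis .
qed

lemma matrix_pos_def_inner_nonneg:
  fixes A :: "real^'n^'n"
  assumes "matrix_pos_def A"
  shows "0 \<le> x \<bullet> (A *v x)"
proof -
  obtain c v where "v \<noteq> 0" "A *v v = c *s v" and le: "c * (x \<bullet> x) \<le> x \<bullet> (A *v x)"
    using min_rayleigh_quotient_eigenvector assms unfolding matrix_pos_def_def by metis
  then have "c > 0"
    using assms unfolding matrix_pos_def_def matrix_eigenvalue_def by blast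
  then have "0 \<le> c * (x \<bullet> x)" by simp
  with le show ?thesis by linarith
qed

lemma norm_matrix_vector_le_spectral_norm:
  "norm (A *v x) \<le> spectral_norm A * norm x"
  unfolding spectral_norm_def by (rule onorm[OF matrix_vector_mul_bounded_linear])

text \<open>Without diagonalising \<open>A\<close>, the bound on the operator norm comes from evaluating the
  nonnegative form at the single vector \<open>M x - A x\<close>.\<close>
lemma spectral_norm_le_if_inner_le:
  fixes A :: "real^'n^'n"
  assumes sym: "transpose A = A" and "M > 0"
    and nonneg: "\<And>x. 0 \<le> x \<bullet> (A *v x)" and le: "\<And>x. x \<bullet> (A *v x) \<le> M * (x \<bullet> x)"
  shows "spectral_norm A \<le> M"
  unfolding spectral_norm_def
proof (rule onorm_le)
  fix x
  define y where "y = A *v x"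
  have "0 \<le> (M *\<^sub>R x - y) \<bullet> (A *v (M *\<^sub>R x - y))"
    by (rule nonneg)
  also have "\<dots> = M\<^sup>2 * (x \<bullet> (A *v x)) - 2 * M * (y \<bullet> y) + y \<bullet> (A *v y)"
    using inner_matrix_vector_swap[OF sym, of x y]
    by (simp add: matrix_vector_mult_diff_distrib matrix_vector_mult_scaleR inner_diff_left
        inner_diff_right y_def[symmetric] power2_eq_square algebra_simps)
  also have "\<dots> \<le> M\<^sup>2 * (M * (x \<bullet> x)) - 2 * M * (y \<bullet> y) + M * (y \<bullet> y)"
    using le[of x] le[of y] \<open>M > 0\<close> by (intro add_mono diff_mono mult_left_mono) auto
  also have "\<dots> = M * (M\<^sup>2 * (x \<bullet> x) - y \<bullet> y)"
    by (simp add: algebra_simps)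
  finally have "y \<bullet> y \<le> M\<^sup>2 * (x \<bullet> x)"
    using \<open>M > 0\<close> by (simp add: zero_le_mult_iff)
  then have "(norm y)\<^sup>2 \<le> (M * norm x)\<^sup>2"
    by (simp add: power_mult_distrib power2_norm_eq_inner)
  then show "norm (A *v x) \<le> M * norm x"
    using \<open>M > 0\<close> by (simp add: y_def power2_le_iff_abs_le)
qed

lemma matrix_vector_inv:
  fixes A :: "real^'n^'n"
  assumes "\<And>x. x \<noteq> 0 \<Longrightarrow> 0 < x \<bullet> (A *v x)"
  shows "A *v (matrix_inv A *v y) = y" and "matrix_inv A *v (A *v y) = y"
proof -
  have "\<forall>x. A *v x = 0 \<longrightarrow> x = 0"
    using assms by force
  then have "invertible A"
    by (simp add: invertible_left_inverse matrix_left_invertible_ker)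
  then have "A ** matrix_inv A = mat 1 \<and> matrix_inv A ** A = mat 1"
    unfolding invertible_def matrix_inv_def by (rule someI_ex)
  then show "A *v (matrix_inv A *v y) = y" and "matrix_inv A *v (A *v y) = y"
    by (simp_all add: matrix_vector_mul_assoc)
qed

text \<open>The lower bound says that \<open>A\<close> stretches every vector by a factor of at least \<open>m\<close>, so its inverse has
  norm at most \<open>1 / m\<close>.\<close>
lemma cond_le_if_inner_bounds:
  fixes A :: "real^'n^'n"
  assumes sym: "transpose A = A" and "m > 0" and "M > 0"
    and ge: "\<And>x. m * (x \<bullet> x) \<le> x \<bullet> (A *v x)" and le: "\<And>x. x \<bullet> (A *v x) \<le> M * (x \<bullet> x)"
  shows "cond A \<le> M / m"
proof -
  have pos: "0 < x \<bullet> (A *v x)" if "x \<noteq> 0" for x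
    using less_le_trans[OF _ ge[of x]] that \<open>m > 0\<close> by simp
  then have nonneg: "0 \<le> x \<bullet> (A *v x)" for x
    by (cases "x = 0") (auto simp: less_imp_le)
  have inv: "spectral_norm (matrix_inv A) \<le> 1 / m"
    unfolding spectral_norm_def
  proof (rule onorm_le)
    fix y
    define x where "x = matrix_inv A *v y"
    have y: "y = A *v x"
      using matrix_vector_inv(1)[of A y] pos by (simp add: x_def)
    have "m * (norm x)\<^sup>2 \<le> x \<bullet> y"
      using ge[of x] by (simp add: y power2_norm_eq_inner)
    also have "\<dots> \<le> norm x * norm y"
      by (rule norm_cauchy_schwarz)
    finally have "m * norm x \<le> norm y"
      by (cases "x = 0") (simp_all add: power2_eq_square)
    then show "norm (matrix_inv A *v y) \<le> 1 / m * norm y"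
      using \<open>m > 0\<close> by (simp add: x_def[symmetric] field_simps)
  qed
  have "0 \<le> spectral_norm (matrix_inv A)"
    unfolding spectral_norm_def by (rule onorm_pos_le[OF matrix_vector_mul_bounded_linear])
  then have "cond A \<le> M * (1 / m)"
    unfolding cond_def using \<open>M > 0\<close> inv spectral_norm_le_if_inner_le[OF sym \<open>M > 0\<close> nonneg le]
    by (intro mult_mono) auto
  then show ?thesis by simp
qed

text \<open>The bounds are the smallest eigenvalue and the spectral norm; an eigenvector
  for the smallest eigenvalue shows that the inverse has norm at least \<open>1 / m\<close>.\<close>
lemma cond_sharp_inner_bounds:
  fixes A :: "real^'n^'n"
  assumes sym: "transpose A = A" and pos: "\<And>x. x \<noteq> 0 \<Longrightarrow> 0 < x \<bullet> (A *v x)"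
  obtains m M where "m > 0" and "M > 0"
    and "\<And>x. m * (x \<bullet> x) \<le> x \<bullet> (A *v x)" and "\<And>x. x \<bullet> (A *v x) \<le> M * (x \<bullet> x)"
    and "M / m \<le> cond A"
proof -
  define M where "M = spectral_norm A"
  have le: "x \<bullet> (A *v x) \<le> M * (x \<bullet> x)" for x
  proof -
    have "x \<bullet> (A *v x) \<le> norm x * norm (A *v x)"
      by (rule norm_cauchy_schwarz)
    also have "\<dots> \<le> norm x * (M * norm x)"
      unfolding M_def by (intro mult_left_mono norm_matrix_vector_le_spectral_norm) simp
    finally show ?thesis
      by (simp add: power2_norm_eq_inner[symmetric] power2_eq_square mult_ac)
  qed
  obtain m v where "v \<noteq> 0" and eig: "A *v v = m *s v"
    and ge: "\<And>x. m * (x \<bullet> x) \<le> x \<bullet> (A *v x)"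
    by (rule min_rayleigh_quotient_eigenvector[OF sym]) (rule that)
  have "v \<bullet> v > 0" using \<open>v \<noteq> 0\<close> by simp
  have "m * (v \<bullet> v) > 0"
    using pos[OF \<open>v \<noteq> 0\<close>] by (simp add: eig scalar_mult_eq_scaleR)
  then have "m > 0"
    using \<open>v \<bullet> v > 0\<close> by (rule zero_less_mult_pos2)
  have "M * (v \<bullet> v) > 0"
    using pos[OF \<open>v \<noteq> 0\<close>] le[of v] by linarith
  then have "M > 0"
    using \<open>v \<bullet> v > 0\<close> by (rule zero_less_mult_pos2)
  have "v = m *\<^sub>R (matrix_inv A *v v)"
    using matrix_vector_inv(2)[of A v] pos
    by (simp add: eig scalar_mult_eq_scaleR matrix_vector_mult_scaleR)
  then have "norm v = m * norm (matrix_inv A *v v)"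
    using \<open>m > 0\<close> by (metis abs_of_pos norm_scaleR)
  also have "\<dots> \<le> m * (spectral_norm (matrix_inv A) * norm v)"
    using \<open>m > 0\<close> by (intro mult_left_mono norm_matrix_vector_le_spectral_norm) simp
  finally have "1 / m \<le> spectral_norm (matrix_inv A)"
    using \<open>m > 0\<close> \<open>v \<noteq> 0\<close> by (simp add: field_simps)
  then have "M * (1 / m) \<le> cond A"
    unfolding cond_def M_def[symmetric] using \<open>M > 0\<close> by (intro mult_left_mono) auto
  then have "M / m \<le> cond A" by simp
  from that[OF \<open>m > 0\<close> \<open>M > 0\<close> ge le this] show thesis .
qed

text \<open>The sharp bounds for the quadratic form of \<open>A\<close> carry over to its Hadamard product with \<open>B\<close>.\<close>
theorem cond_hadamard_le:
  fixes A B :: "real^'n^'n"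
  assumes symA: "transpose A = A" and A: "\<And>x. x \<noteq> 0 \<Longrightarrow> 0 < x \<bullet> (A *v x)"
    and symB: "transpose B = B" and B: "\<And>x. 0 \<le> x \<bullet> (B *v x)" and diag: "\<And>i. B $ i $ i = 1"
  shows "cond (A \<circ>\<^sub>H B) \<le> cond A"
proof -
  obtain m M where "m > 0" and "M > 0"
    and ge: "\<And>x. m * (x \<bullet> x) \<le> x \<bullet> (A *v x)" and le: "\<And>x. x \<bullet> (A *v x) \<le> M * (x \<bullet> x)"
    and sharp: "M / m \<le> cond A"
    by (rule cond_sharp_inner_bounds[OF symA A]) (assumption, rule that)
  have "transpose (A \<circ>\<^sub>H B) = A \<circ>\<^sub>H B"
    using symA symB by (simp add: hadamard_def transpose_def vec_eq_iff)
  then have "cond (A \<circ>\<^sub>H B) \<le> M / m"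
    using inner_hadamard_ge[OF symA ge symB B diag] inner_hadamard_le[OF symA le symB B diag]
    by (intro cond_le_if_inner_bounds \<open>m > 0\<close> \<open>M > 0\<close>)
  with sharp show ?thesis by linarith
qed

section \<open>Variably scaled kernels\<close>

text \<open>The exponents on the left have the quadratic part \<open>\<epsilon>\<^sup>2 * (r\<^sup>2 - d\<^sup>2 - h\<^sup>2)\<close>, which vanishes.\<close>
lemma variably_scaled_entry_identity:
  fixes d r \<epsilon> h :: real
  assumes "r\<^sup>2 = d\<^sup>2 + h\<^sup>2"
  shows "exp (- \<epsilon> * d) powr (\<epsilon> * d - 1) * exp (- (\<epsilon>\<^sup>2) * h\<^sup>2)
      * (1 / exp (- \<epsilon> * r) powr (\<epsilon> * r - 1)) = exp (\<epsilon> * d - \<epsilon> * r)"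
proof -
  have "(\<epsilon> * d - 1) * (- \<epsilon> * d) + - (\<epsilon>\<^sup>2) * h\<^sup>2 - (\<epsilon> * r - 1) * (- \<epsilon> * r)
      = \<epsilon> * d - \<epsilon> * r + \<epsilon>\<^sup>2 * (r\<^sup>2 - (d\<^sup>2 + h\<^sup>2))"
    by (simp add: power2_eq_square algebra_simps)
  then have "(\<epsilon> * d - 1) * (- \<epsilon> * d) + - (\<epsilon>\<^sup>2) * h\<^sup>2 - (\<epsilon> * r - 1) * (- \<epsilon> * r)
      = \<epsilon> * d - \<epsilon> * r"
    using assms by simp
  then show ?thesis
    by (simp only: powr_def ln_exp exp_not_eq_zero if_False mult_exp_exp exp_diff[symmetric]
        times_divide_eq_right mult_1_right)
qed

theorem proposition3p2:
  fixes U :: "(real^'d) set" and \<Sigma> :: "(real^'m) set"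
    and \<epsilon> :: real
    and u :: "'n::finite \<Rightarrow> real^'d"
    and \<Psi> :: "real^'d \<Rightarrow> real^'m"
    and K K\<Psi> K\<^sub>G D D\<Psi> :: "real^'n^'n"
  assumes "\<epsilon> > 0"
    and "inj u" and "range u \<subseteq> U"
    and "\<Psi> ` U \<subseteq> \<Sigma>"
    and "K = kernel_matrix (matern \<epsilon>) u"
    and "K\<Psi> = kernel_matrix (vs_matern \<epsilon> \<Psi>) u"
    and "K\<^sub>G = kernel_matrix (gaussian \<epsilon>) (\<Psi> \<circ> u)"
    and "D = distance_matrix u"
    and "D\<Psi> = distance_matrix (scaled_point \<Psi> \<circ> u)"
    and "matrix_pos_def (hadamard_powr K (scale_minus_one \<epsilon> D) \<circ>\<^sub>H K\<^sub>G
           \<circ>\<^sub>H hadamard_inverse (hadamard_powr K\<Psi> (scale_minus_one \<epsilon> D\<Psi>)))"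
  shows "cond K\<Psi> \<le> cond K"
proof -
  define B where "B = hadamard_powr K (scale_minus_one \<epsilon> D) \<circ>\<^sub>H K\<^sub>G
           \<circ>\<^sub>H hadamard_inverse (hadamard_powr K\<Psi> (scale_minus_one \<epsilon> D\<Psi>))"
  define d where "d i j = norm (u i - u j)" for i j
  define r where "r i j = norm (scaled_point \<Psi> (u i) - scaled_point \<Psi> (u j))" for i j
  have K: "K $ i $ j = exp (- \<epsilon> * d i j)" for i j
    by (simp add: assms(5) kernel_matrix_def matern_def d_def)
  have K\<Psi>: "K\<Psi> $ i $ j = exp (- \<epsilon> * r i j)" for i j
    by (simp add: assms(6) kernel_matrix_def vs_matern_def matern_def r_def)
  have B: "B $ i $ j = exp (\<epsilon> * d i j - \<epsilon> * r i j)" for i j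
  proof -
    have "B $ i $ j = exp (- \<epsilon> * d i j) powr (\<epsilon> * d i j - 1)
        * exp (- (\<epsilon>\<^sup>2) * (norm (\<Psi> (u i) - \<Psi> (u j)))\<^sup>2)
        * (1 / exp (- \<epsilon> * r i j) powr (\<epsilon> * r i j - 1))"
      by (simp only: B_def hadamard_def hadamard_powr_def hadamard_inverse_def scale_minus_one_def
          vec_lambda_beta K K\<Psi> assms(7-9) kernel_matrix_def gaussian_def distance_matrix_def
          comp_apply d_def r_def)
    moreover have "(r i j)\<^sup>2 = (d i j)\<^sup>2 + (norm (\<Psi> (u i) - \<Psi> (u j)))\<^sup>2"
      by (simp add: r_def d_def scaled_point_def norm_Pair)
    ultimately show ?thesis
      by (simp only: variably_scaled_entry_identity)
  qed
  have "K\<Psi> = K \<circ>\<^sub>H B"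
    by (simp add: vec_eq_iff hadamard_def K K\<Psi> B mult_exp_exp)
  moreover have "cond (K \<circ>\<^sub>H B) \<le> cond K"
  proof (rule cond_hadamard_le)
    show "transpose K = K"
      by (simp add: vec_eq_iff transpose_def K d_def norm_minus_commute)
    show "0 < x \<bullet> (K *v x)" if nonzero: "x \<noteq> 0" for x
    proof -
      obtain k where "x $ k \<noteq> 0"
        using nonzero by (metis vec_eq_iff zero_index)
      then have "0 < quad_form UNIV (\<lambda>i j. matern \<epsilon> (u i) (u j)) (\<lambda>i. x $ i)"
        using assms(1,2) by (intro matern_strictly_pos_def) auto
      then show ?thesis
        by (simp add: inner_matrix_vector_eq_quad_form assms(5) kernel_matrix_def)
    qed
    show "transpose B = B"
      using assms(10) by (simp add: B_def matrix_pos_def_def)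
    show "0 \<le> x \<bullet> (B *v x)" for x
      using assms(10) unfolding B_def by (rule matrix_pos_def_inner_nonneg)
    show "B $ i $ i = 1" for i
      by (simp add: B d_def r_def)
  qed
  ultimately show ?thesis by simp
qed

end
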